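(* Fix $\epsilon\in(0,1/8)$. Let $0<p_0<1/2$ and let $W:[0,1]^2\to[p_0,1-p_0]$ be symmetric and Lipschitz with least Lipschitz constant $L>0$, and let $G\sim\mathcal G(n,W)$. Let $w=n^{-1/4}$ and $y=\lceil n^{1/2-\epsilon}\rceil$, and assume that the hypothesis $\mathrm{LLT}(w,y)$ (stated in the context) holds. Then asymptotically almost surely over types, $$\mathbb E[X\mid x]\ \ge\ \exp\Bigl(\tfrac32\epsilon\,y\log n\,(1-o(1))\Bigr)\longrightarrow\infty\quad(n\to\infty),\qquad X:=\sum_{S\subseteq B,\ |S|=y}\mathbf 1_{A_S}.$$
   Context: Model $\mathcal G(n,W)$: draw $x_1,\dots,x_n$ (the types) i.i.d. uniform on $[0,1]$; given $x=(x_1,\dots,x_n)$, join $i\sim j$ independently for distinct pairs, with probability $W(x_i,x_j)$. $\mathbb P(\cdot\mid x)$ and $\mathbb E[\cdot\mid x]$ are conditional on the types, over the edge randomness only; "a.a.s. over types" means for all $x$ in an event whose probability under the type randomness tends to $1$ as $n\to\infty$. A graph is regular if all its degrees are equal. Window: fix $c_0\in[0,1-w]$ and let $B:=\{i:x_i\in[c_0,c_0+w]\}$. For $S\subseteq B$ with $|S|=y$, let $A_S$ be the event that $G[S]$ is regular, $\mu_v(S):=\sum_{u\in S\setminus\{v\}}W(x_u,x_v)$ for $v\in S$, and $\bar\mu_S:=y^{-1}\sum_{v\in S}\mu_v(S)$. Hypothesis $\mathrm{LLT}(w,y)$ (local limit lower bound): there exist $c,C>0$ depending only on $p_0$ such that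 a.a.s. over types, for every $S\subseteq B$ with $|S|=y$, with $t$ the least integer $\ge\bar\mu_S$ such that $ty$ is even, $$\mathbb P\bigl(G[S]\text{ is }t\text{-regular}\mid x\bigr)\ \ge\ \Bigl(\frac{c}{\sqrt y}\Bigr)^{y-1}\exp\Bigl(-\frac{C}{y}\sum_{v\in S}\bigl(t-\mu_v(S)\bigr)^2\Bigr).$$ Logarithms are natural. *)

theory Defs
  imports "HOL-Probability.Probability" "HOL-Probability.Product_PMF"
begin

text \<open>
  A simple graph on a given vertex set is represented by its set of edges, each edge being
  a two-element set of vertices.
\<close>

type_synonym edges = "nat set set"

definition induced_edges :: "edges \<Rightarrow> nat set \<Rightarrow> edges" where
  "induced_edges E S = {e \<in> E. e \<subseteq> S}"

definition vertex_degree :: "edges \<Rightarrow> nat \<Rightarrow> nat" where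
  "vertex_degree E v = card {e \<in> E. v \<in> e}"

definition regular_of_degree :: "nat \<Rightarrow> nat set \<Rightarrow> edges \<Rightarrow> bool" where
  "regular_of_degree t V E \<longleftrightarrow> (\<forall>v\<in>V. vertex_degree E v = t)"

definition regular_graph :: "nat set \<Rightarrow> edges \<Rightarrow> bool" where
  "regular_graph V E \<longleftrightarrow> (\<exists>t. regular_of_degree t V E)"

definition types_measure :: "nat \<Rightarrow> (nat \<Rightarrow> real) measure" where
  "types_measure n = (\<Pi>\<^sub>M i\<in>{1..n}. uniform_measure lborel {0..1})"

definition aas_types :: "(nat \<Rightarrow> (nat \<Rightarrow> real) \<Rightarrow> bool) \<Rightarrow> bool" where
  "aas_types P \<longleftrightarrow>
     (\<exists>A. (\<forall>n. A n \<in> sets (types_measure n)) \<and>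
          (\<lambda>n. measure (types_measure n) (A n)) \<longlonglongrightarrow> 1 \<and>
          (\<forall>n. \<forall>x\<in>A n. P n x))"

definition vertex_pairs :: "nat \<Rightarrow> (nat \<times> nat) set" where
  "vertex_pairs n = {(i, j). 1 \<le> i \<and> i < j \<and> j \<le> n}"

text \<open>
  The law of the graph conditional on the types \<open>x\<close>.  It realises the conditional
  probability and expectation given \<open>x\<close> for every \<open>x\<close>, not only up to null sets.
\<close>

definition graph_given_types ::
    "nat \<Rightarrow> (real \<times> real \<Rightarrow> real) \<Rightarrow> (nat \<Rightarrow> real) \<Rightarrow> edges pmf" where
  "graph_given_types n W x =
     map_pmf (\<lambda>g. {{i, j} |i j. (i, j) \<in> vertex_pairs n \<and> g (i, j)})
       (Pi_pmf (vertex_pairs n) False (\<lambda>(i, j). bernoulli_pmf (W (x i, x j))))"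

definition window :: "nat \<Rightarrow> real \<Rightarrow> real \<Rightarrow> (nat \<Rightarrow> real) \<Rightarrow> nat set" where
  "window n c0 w x = {i \<in> {1..n}. x i \<in> {c0..c0 + w}}"

definition mean_degree ::
    "(real \<times> real \<Rightarrow> real) \<Rightarrow> (nat \<Rightarrow> real) \<Rightarrow> nat set \<Rightarrow> nat \<Rightarrow> real" where
  "mean_degree W x S v = (\<Sum>u\<in>S - {v}. W (x u, x v))"

definition avg_mean_degree ::
    "(real \<times> real \<Rightarrow> real) \<Rightarrow> (nat \<Rightarrow> real) \<Rightarrow> nat set \<Rightarrow> real" where
  "avg_mean_degree W x S = (\<Sum>v\<in>S. mean_degree W x S v) / real (card S)"

text \<open>
  For \<open>W \<ge> 0\<close> the average is nonnegative, so the least admissible integer is a natural number.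
\<close>

definition target_degree ::
    "(real \<times> real \<Rightarrow> real) \<Rightarrow> (nat \<Rightarrow> real) \<Rightarrow> nat set \<Rightarrow> nat" where
  "target_degree W x S = (LEAST t. avg_mean_degree W x S \<le> real t \<and> even (t * card S))"

text \<open>
  The local limit lower bound.  The constants are chosen before \<open>n\<close>, the types and \<open>S\<close>.
  They are not required to be common to all kernels with the same range bounds: as a
  hypothesis about a single \<open>W\<close>, this is implied by the version with constants that depend
  only on these bounds.
\<close>

definition LLT ::
    "(real \<times> real \<Rightarrow> real) \<Rightarrow> (nat \<Rightarrow> real) \<Rightarrow> (nat \<Rightarrow> real) \<Rightarrow> (nat \<Rightarrow> nat) \<Rightarrow> bool" where
  "LLT W c0 w y \<longleftrightarrow>
     (\<exists>c>0. \<exists>C>0. aas_types (\<lambda>n x.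
        \<forall>S. S \<subseteq> window n (c0 n) (w n) x \<and> card S = y n \<longrightarrow>
          (let t = target_degree W x S in
            measure_pmf.prob (graph_given_types n W x)
                {E. regular_of_degree t S (induced_edges E S)}
              \<ge> (c / sqrt (real (y n))) ^ (y n - 1) *
                 exp (- (C / real (y n)) * (\<Sum>v\<in>S. (real t - mean_degree W x S v)\<^sup>2)))))"

definition num_regular_subsets :: "nat set \<Rightarrow> nat \<Rightarrow> edges \<Rightarrow> real" where
  "num_regular_subsets B y E =
     (\<Sum>S | S \<subseteq> B \<and> card S = y. of_bool (regular_graph S (induced_edges E S)))"

end

theory Submission imports Defs begin

text \<open>
  The expectation of \<open>X\<close> is a sum, over the \<open>y\<close>-subsets \<open>S\<close> of the window \<open>B\<close>, of the probability
  that \<open>G[S]\<close> is regular, and \<open>LLT\<close> bounds each term from below.  Randomness of the types enters only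
  through \<open>LLT\<close> and through the size of \<open>B\<close>; the rest of the argument works for each fixed \<open>x\<close>.
  Here \<open>w = n powr (-1/4)\<close>, and \<open>y\<close> is \<open>n powr (1/2 - \<epsilon>)\<close> up to a factor of 2.  Three quantities matter.

  \<^item> The number of terms.  By Hoeffding's inequality a.a.s. \<open>card B \<ge> n powr (3/4) / 2\<close>
    (\<open>aas_types_window_ge\<close>), so that the number of \<open>y\<close>-subsets is at least
    \<open>(card B / y) ^ y \<ge> (n powr (1/4 + \<epsilon>) / 4) ^ y\<close>.
  \<^item> The Gaussian prefactor \<open>(c / sqrt y) ^ (y - 1)\<close>, which is
    \<open>n powr (- (1/4 - \<epsilon>/2) * y)\<close> up to a factor \<open>exp (O(y))\<close>.
  \<^item> The exponential penalty.  In a window of width \<open>w\<close> the Lipschitz condition forces all mean degrees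
    to agree up to \<open>L w y\<close>, and rounding moves the target degree by at most 2.  The penalty exponent
    is therefore at most \<open>C (2 + L w y)\<^sup>2\<close> (\<open>sum_target_deviation_le\<close>), which is \<open>O(y)\<close> because
    \<open>w\<^sup>2 y\<close> is bounded.

  The powers of \<open>n\<close> add up to \<open>(1/4 + \<epsilon>) - (1/4 - \<epsilon>/2) = 3/2 \<epsilon>\<close> per vertex of \<open>S\<close>, and everything else
  costs a factor \<open>exp (K y)\<close> with a constant \<open>K\<close> (\<open>binomial_times_llt_bound_ge\<close>).  So \<open>\<delta> n\<close> can be taken
  to be \<open>K\<close> divided by \<open>3/2 \<epsilon> ln n\<close>, and the exponent \<open>y (3/2 \<epsilon> ln n - K)\<close> tends to infinity.
\<close>

section \<open>Mean degrees inside a narrow window\<close>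

text \<open>
  The vertices \<open>u\<close> and \<open>v\<close> see the same third vertices, each with nearly equal weight, and by symmetry
  they give the same weight to each other.
\<close>

lemma mean_degree_diff_le:
  assumes "finite S" "u \<in> S" "v \<in> S"
    and X: "x ` S \<subseteq> X"
    and sym: "\<And>a b. a \<in> X \<Longrightarrow> b \<in> X \<Longrightarrow> W (a, b) = W (b, a)"
    and lip: "L-lipschitz_on (X \<times> X) W"
    and width: "\<And>u v. u \<in> S \<Longrightarrow> v \<in> S \<Longrightarrow> \<bar>x u - x v\<bar> \<le> w"
  shows "\<bar>mean_degree W x S u - mean_degree W x S v\<bar> \<le> L * w * real (card S)"
proof -
  have L: "0 \<le> L" using lip by (rule lipschitz_on_nonneg)
  have w: "0 \<le> w" using width[OF \<open>u \<in> S\<close> \<open>u \<in> S\<close>] by simp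
  show ?thesis
  proof (cases "u = v")
    case True
    then show ?thesis using L w by simp
  next
    case False
    let ?R = "S - {u, v}"
    have Su: "S - {u} = insert v ?R" and Sv: "S - {v} = insert u ?R"
      using False assms(2,3) by auto
    have eq: "mean_degree W x S u - mean_degree W x S v
        = (\<Sum>z\<in>?R. W (x z, x u) - W (x z, x v))"
    proof -
      have "mean_degree W x S u = W (x v, x u) + (\<Sum>z\<in>?R. W (x z, x u))"
        unfolding mean_degree_def Su using assms(1) by (subst sum.insert) auto
      moreover have "mean_degree W x S v = W (x u, x v) + (\<Sum>z\<in>?R. W (x z, x v))"
        unfolding mean_degree_def Sv using assms(1) by (subst sum.insert) auto
      moreover have "W (x v, x u) = W (x u, x v)"
        using assms(2,3) X by (intro sym) auto
      ultimately show ?thesis by (simp add: sum_subtractf)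
    qed
    have "\<bar>W (x z, x u) - W (x z, x v)\<bar> \<le> L * w" if "z \<in> ?R" for z
    proof -
      have "dist (W (x z, x u)) (W (x z, x v)) \<le> L * dist (x z, x u) (x z, x v)"
        using that assms(2,3) X by (intro lipschitz_onD[OF lip]) auto
      also have "\<dots> = L * \<bar>x u - x v\<bar>"
        by (simp add: dist_Pair_Pair dist_real_def)
      also have "\<dots> \<le> L * w"
        using L width[OF assms(2,3)] by (rule mult_left_mono[rotated])
      finally show ?thesis by (simp add: dist_real_def)
    qed
    then have "\<bar>\<Sum>z\<in>?R. W (x z, x u) - W (x z, x v)\<bar> \<le> (\<Sum>z\<in>?R. L * w)"
      by (intro order.trans[OF sum_abs] sum_mono)
    also have "\<dots> = L * w * real (card ?R)" by simp
    also have "\<dots> \<le> L * w * real (card S)"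
      using L w \<open>finite S\<close> by (intro mult_left_mono) (auto intro: card_mono)
    finally show ?thesis using eq by simp
  qed
qed

lemma mean_degree_diff_avg_le:
  assumes "finite S" "v \<in> S"
    and diff: "\<And>u. u \<in> S \<Longrightarrow> \<bar>mean_degree W x S u - mean_degree W x S v\<bar> \<le> D"
  shows "\<bar>avg_mean_degree W x S - mean_degree W x S v\<bar> \<le> D"
proof -
  have pos: "0 < real (card S)" using assms(1,2) by (auto simp: card_gt_0_iff)
  have "avg_mean_degree W x S - mean_degree W x S v
      = (\<Sum>u\<in>S. mean_degree W x S u - mean_degree W x S v) / real (card S)"
    using pos by (simp add: avg_mean_degree_def sum_subtractf field_simps)
  also have "\<bar>\<dots>\<bar> \<le> (\<Sum>u\<in>S. D) / real (card S)"
    using pos by (auto simp: abs_divide intro!: divide_right_mono order.trans[OF sum_abs] sum_mono diff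
        simp del: sum_constant)
  also have "\<dots> = D" using pos by simp
  finally show ?thesis .
qed

text \<open>
  Of the two integers that follow the average upwards, one is even, so rounding up to an admissible
  degree costs at most 2.
\<close>

lemma target_degree_bounds:
  assumes "0 \<le> avg_mean_degree W x S"
  shows "avg_mean_degree W x S \<le> real (target_degree W x S)"
    and "real (target_degree W x S) \<le> avg_mean_degree W x S + 2"
proof -
  let ?P = "\<lambda>t. avg_mean_degree W x S \<le> real t \<and> even (t * card S)"
  let ?k = "nat \<lceil>avg_mean_degree W x S\<rceil>"
  define k where "k = (if even ?k then ?k else ?k + 1)"
  have k: "avg_mean_degree W x S \<le> real k" "real k \<le> avg_mean_degree W x S + 2" "even k"
    using assms unfolding k_def by (auto; linarith)+
  then have "?P k" by simp
  then have "?P (target_degree W x S)" "target_degree W x S \<le> k"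
    unfolding target_degree_def by (rule LeastI, rule Least_le)
  with k show "avg_mean_degree W x S \<le> real (target_degree W x S)"
    and "real (target_degree W x S) \<le> avg_mean_degree W x S + 2" by auto
qed

lemma sum_target_deviation_le:
  assumes "finite S"
    and X: "x ` S \<subseteq> X"
    and sym: "\<And>a b. a \<in> X \<Longrightarrow> b \<in> X \<Longrightarrow> W (a, b) = W (b, a)"
    and lip: "L-lipschitz_on (X \<times> X) W"
    and nonneg: "\<And>a b. a \<in> X \<Longrightarrow> b \<in> X \<Longrightarrow> 0 \<le> W (a, b)"
    and width: "\<And>u v. u \<in> S \<Longrightarrow> v \<in> S \<Longrightarrow> \<bar>x u - x v\<bar> \<le> w"
  shows "(\<Sum>v\<in>S. (real (target_degree W x S) - mean_degree W x S v)\<^sup>2)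
    \<le> real (card S) * (2 + L * w * real (card S))\<^sup>2"
proof -
  have "0 \<le> avg_mean_degree W x S"
    unfolding avg_mean_degree_def mean_degree_def using X
    by (intro divide_nonneg_nonneg sum_nonneg nonneg) auto
  note t = target_degree_bounds[OF this]
  have "(\<Sum>v\<in>S. (real (target_degree W x S) - mean_degree W x S v)\<^sup>2)
      \<le> (\<Sum>v\<in>S. (2 + L * w * real (card S))\<^sup>2)"
  proof (rule sum_mono)
    fix v assume v: "v \<in> S"
    have "\<bar>avg_mean_degree W x S - mean_degree W x S v\<bar> \<le> L * w * real (card S)"
      using \<open>finite S\<close> v by (rule mean_degree_diff_avg_le)
        (rule mean_degree_diff_le[OF \<open>finite S\<close> _ v X sym lip width])
    then have "\<bar>real (target_degree W x S) - mean_degree W x S v\<bar> \<le> 2 + L * w * real (card S)"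
      using t by linarith
    then show "(real (target_degree W x S) - mean_degree W x S v)\<^sup>2 \<le> (2 + L * w * real (card S))\<^sup>2"
      by (simp add: abs_le_square_iff[symmetric])
  qed
  then show ?thesis by simp
qed

section \<open>The expected number of regular subsets\<close>

text \<open>
  Linearity of expectation needs no relation between different sets, so each \<open>S\<close> may have its own degree
  \<open>t S\<close>; regularity of that one degree already makes \<open>S\<close> count.
\<close>

lemma expectation_num_regular_subsets_ge:
  assumes "finite B"
    and q: "\<And>S. S \<subseteq> B \<Longrightarrow> card S = y \<Longrightarrow>
      q \<le> measure_pmf.prob p {E. regular_of_degree (t S) S (induced_edges E S)}"
  shows "real (card B choose y) * q \<le> measure_pmf.expectation p (num_regular_subsets B y)"
proof -
  let ?F = "{S. S \<subseteq> B \<and> card S = y}"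
  let ?R = "\<lambda>S. {E. regular_graph S (induced_edges E S)}"
  have "real (card B choose y) * q = (\<Sum>S\<in>?F. q)"
    unfolding sum_constant n_subsets[OF \<open>finite B\<close>] ..
  also have "\<dots> \<le> (\<Sum>S\<in>?F. measure_pmf.prob p (?R S))"
  proof (rule sum_mono)
    fix S assume "S \<in> ?F"
    then have "q \<le> measure_pmf.prob p {E. regular_of_degree (t S) S (induced_edges E S)}"
      using q by simp
    also have "\<dots> \<le> measure_pmf.prob p (?R S)"
      by (intro measure_pmf.finite_measure_mono) (auto simp: regular_graph_def)
    finally show "q \<le> measure_pmf.prob p (?R S)" .
  qed
  also have "\<dots> = (\<Sum>S\<in>?F. measure_pmf.expectation p (indicator (?R S)))"
    by simp
  also have "\<dots> = measure_pmf.expectation p (\<lambda>E. \<Sum>S\<in>?F. indicator (?R S) E)"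
    by (rule Bochner_Integration.integral_sum[symmetric])
      (auto intro!: measure_pmf.integrable_const_bound[where B = 1] simp: indicator_def)
  also have "(\<lambda>E. \<Sum>S\<in>?F. indicator (?R S) E) = num_regular_subsets B y"
    by (simp add: fun_eq_iff num_regular_subsets_def indicator_def)
  finally show ?thesis .
qed

section \<open>Almost sure events over the types\<close>

lemma prob_space_uniform_01: "prob_space (uniform_measure lborel {0..1::real})"
  by (rule prob_space_uniform_measure) auto

lemma prob_space_types_measure: "prob_space (types_measure n)"
  unfolding types_measure_def by (intro prob_space_PiM prob_space_uniform_01)

lemma aas_typesI:
  assumes "\<forall>\<^sub>F n in sequentially. {x \<in> space (types_measure n). P n x} \<in> sets (types_measure n) \<and>
      1 - r n \<le> measure (types_measure n) {x \<in> space (types_measure n). P n x}"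
    and "r \<longlonglongrightarrow> 0"
  shows "aas_types P"
proof -
  \<comment> \<open>The event may fail to be measurable for finitely many \<open>n\<close>; there the empty set serves.\<close>
  define A where "A n = (if {x \<in> space (types_measure n). P n x} \<in> sets (types_measure n)
    then {x \<in> space (types_measure n). P n x} else {})" for n
  have "(\<lambda>n. measure (types_measure n) (A n)) \<longlonglongrightarrow> 1"
  proof (rule tendsto_sandwich[where f = "\<lambda>n. 1 - r n" and h = "\<lambda>_. 1"])
    show "\<forall>\<^sub>F n in sequentially. 1 - r n \<le> measure (types_measure n) (A n)"
      using assms(1) by eventually_elim (auto simp: A_def)
    show "\<forall>\<^sub>F n in sequentially. measure (types_measure n) (A n) \<le> 1"
      by (intro always_eventually allI prob_space.prob_le_1 prob_space_types_measure)
    show "(\<lambda>n. 1 - r n) \<longlonglongrightarrow> 1"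
      using tendsto_diff[OF tendsto_const assms(2), of 1] by simp
  qed simp
  moreover have "\<forall>n. A n \<in> sets (types_measure n)" and "\<forall>n. \<forall>x\<in>A n. P n x"
    by (auto simp: A_def)
  ultimately show ?thesis unfolding aas_types_def by blast
qed

lemma aas_types_conj_mono:
  assumes P: "aas_types P" and Q: "aas_types Q"
    and R: "\<forall>\<^sub>F n in sequentially. \<forall>x. P n x \<longrightarrow> Q n x \<longrightarrow> R n x"
  shows "aas_types R"
proof -
  from P obtain A where A: "\<And>n. A n \<in> sets (types_measure n)"
    "(\<lambda>n. measure (types_measure n) (A n)) \<longlonglongrightarrow> 1" "\<And>n x. x \<in> A n \<Longrightarrow> P n x"
    unfolding aas_types_def by blast
  from Q obtain B where B: "\<And>n. B n \<in> sets (types_measure n)"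
    "(\<lambda>n. measure (types_measure n) (B n)) \<longlonglongrightarrow> 1" "\<And>n x. x \<in> B n \<Longrightarrow> Q n x"
    unfolding aas_types_def by blast
  define D where "D n = (if \<forall>x. P n x \<longrightarrow> Q n x \<longrightarrow> R n x then A n \<inter> B n else {})" for n
  have "(\<lambda>n. measure (types_measure n) (D n)) \<longlonglongrightarrow> 1"
  proof (rule tendsto_sandwich[where h = "\<lambda>_. 1"])
    show "\<forall>\<^sub>F n in sequentially.
        measure (types_measure n) (A n) + measure (types_measure n) (B n) - 1
        \<le> measure (types_measure n) (D n)"
      using R
    proof eventually_elim
      case (elim n)
      interpret prob_space "types_measure n" by (rule prob_space_types_measure)
      have "prob (A n \<union> B n) = prob (A n) + prob (B n) - prob (A n \<inter> B n)"
        using A(1) B(1) by (simp add: measure_Un3 fmeasurable_eq_sets)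
      then show ?case using elim prob_le_1[of "A n \<union> B n"] by (simp add: D_def)
    qed
    show "\<forall>\<^sub>F n in sequentially. measure (types_measure n) (D n) \<le> 1"
      by (intro always_eventually allI prob_space.prob_le_1 prob_space_types_measure)
    show "(\<lambda>n. measure (types_measure n) (A n) + measure (types_measure n) (B n) - 1) \<longlonglongrightarrow> 1"
      using tendsto_diff[OF tendsto_add[OF A(2) B(2)] tendsto_const, of 1] by simp
  qed simp
  moreover have "\<forall>n. D n \<in> sets (types_measure n)" and "\<forall>n. \<forall>x\<in>D n. R n x"
    using A B by (auto simp: D_def)
  ultimately show ?thesis unfolding aas_types_def by blast
qed

section \<open>The size of the window\<close>

text \<open>Independence holds because the joint law of the coordinates is the product of their marginals.\<close>

lemma indep_vars_types:
  assumes "0 < n"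
  shows "prob_space.indep_vars (types_measure n) (\<lambda>_. borel) (\<lambda>i x. x i) {1..n}"
proof -
  interpret prob_space "types_measure n" by (rule prob_space_types_measure)
  let ?U = "uniform_measure lborel {0..1::real}"
  have rv: "random_variable borel (\<lambda>x. x i)" if "i \<in> {1..n}" for i
    unfolding types_measure_def using measurable_component_singleton[OF that, of "\<lambda>_. ?U"]
    by (simp cong: measurable_cong_sets)
  have marg: "distr (types_measure n) borel (\<lambda>x. x i) = ?U" if "i \<in> {1..n}" for i
  proof -
    have "distr (types_measure n) borel (\<lambda>x. x i) = distr (types_measure n) ?U (\<lambda>x. x i)"
      by (intro distr_cong) auto
    also have "\<dots> = ?U"
      unfolding types_measure_def by (rule distr_PiM_component[OF prob_space_uniform_01 that])
    finally show ?thesis .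
  qed
  have "distr (types_measure n) (Pi\<^sub>M {1..n} (\<lambda>_. borel)) (\<lambda>x. \<lambda>i\<in>{1..n}. x i)
      = distr (types_measure n) (types_measure n) (\<lambda>x. x)"
  proof (rule distr_cong)
    show "sets (Pi\<^sub>M {1..n} (\<lambda>_. borel)) = sets (types_measure n)"
      unfolding types_measure_def by (intro sets_PiM_cong) auto
    show "(\<lambda>i\<in>{1..n}. x i) = x" if "x \<in> space (types_measure n)" for x
      using that by (auto simp: types_measure_def space_PiM)
  qed simp
  also have "\<dots> = types_measure n" by (rule distr_id)
  also have "\<dots> = Pi\<^sub>M {1..n} (\<lambda>i. distr (types_measure n) borel (\<lambda>x. x i))"
    unfolding types_measure_def
    by (rule PiM_cong) (use marg in \<open>auto simp: types_measure_def\<close>)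
  finally show ?thesis
    using \<open>0 < n\<close> rv by (subst indep_vars_iff_distr_eq_PiM') auto
qed

text \<open>
  Each type falls into an interval \<open>[c, c + w]\<close> inside the unit interval with probability \<open>w\<close>, so
  the window has mean size \<open>n w\<close>, and Hoeffding's inequality applies to the sum of indicators.
\<close>

lemma prob_window_ge:
  assumes "0 < n" "0 \<le> w" "0 \<le> c" "c + w \<le> 1"
  shows "{x \<in> space (types_measure n). real n * w / 2 \<le> real (card (window n c w x))}
      \<in> sets (types_measure n)" (is "?good \<in> _")
    and "1 - exp (- (real n * w\<^sup>2 / 2))
      \<le> measure (types_measure n)
          {x \<in> space (types_measure n). real n * w / 2 \<le> real (card (window n c w x))}"
proof -
  interpret prob_space "types_measure n" by (rule prob_space_types_measure)
  let ?U = "uniform_measure lborel {0..1::real}"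
  define X where "X i x = (indicator {c..c + w} (x i) :: real)" for i :: nat and x :: "nat \<Rightarrow> real"
  have indep: "indep_vars (\<lambda>_. borel) X {1..n}"
    unfolding X_def by (rule indep_vars_compose2[OF indep_vars_types[OF \<open>0 < n\<close>]]) simp
  interpret Hoeffding_ineq "types_measure n" "{1..n}" X "\<lambda>_. 0" "\<lambda>_. 1"
      "\<Sum>i\<in>{1..n}. expectation (X i)"
  proof unfold_locales
    show "indep_vars (\<lambda>_. borel) X {1..n}" by (rule indep)
    show "AE x in types_measure n. X i x \<in> {0..1}" for i
      by (intro AE_I2) (simp add: X_def)
  qed simp
  have card: "(\<Sum>i\<in>{1..n}. X i x) = real (card (window n c w x))" for x
  proof -
    have "(\<Sum>i\<in>{1..n}. X i x) = (\<Sum>i\<in>window n c w x. 1)"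
      by (rule sum.mono_neutral_cong_right) (auto simp: X_def window_def)
    then show ?thesis by simp
  qed
  have E: "expectation (X i) = w" if "i \<in> {1..n}" for i
  proof -
    have meas: "(\<lambda>x. x i) \<in> measurable (types_measure n) ?U"
      unfolding types_measure_def by (rule measurable_component_singleton[OF that])
    have "expectation (X i) = (\<integral>z. indicator {c..c + w} z \<partial>distr (types_measure n) ?U (\<lambda>x. x i))"
      unfolding X_def by (rule integral_distr[symmetric, OF meas]) simp
    also have "distr (types_measure n) ?U (\<lambda>x. x i) = ?U"
      unfolding types_measure_def by (rule distr_PiM_component[OF prob_space_uniform_01 that])
    also have "(\<integral>z. indicator {c..c + w} z \<partial>?U) = measure ?U {c..c + w}" by simp
    also have "\<dots> = w"
    proof -
      have "{0..1} \<inter> {c..c + w} = {c..c + w}" using assms by auto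
      then show ?thesis using assms by (subst measure_uniform_measure) auto
    qed
    finally show ?thesis .
  qed
  have [measurable]: "(\<lambda>x. \<Sum>i\<in>{1..n}. X i x) \<in> borel_measurable (types_measure n)"
    using random_variable by (intro borel_measurable_sum) auto
  have "{x \<in> space (types_measure n). real n * w / 2 \<le> (\<Sum>i\<in>{1..n}. X i x)} \<in> events"
    by measurable
  then show good: "?good \<in> events" by (simp only: card)
  have half: "real n * w - real n * w / 2 = real n * w / 2" by simp
  have "prob {x \<in> space (types_measure n). (\<Sum>i\<in>{1..n}. X i x) \<le> real n * w - real n * w / 2}
      \<le> exp (-2 * (real n * w / 2)\<^sup>2 / real n)"
    using Hoeffding_ineq_le[of "real n * w / 2"] assms by (simp add: E)
  also have "-2 * (real n * w / 2)\<^sup>2 / real n = - (real n * w\<^sup>2 / 2)"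
    using \<open>0 < n\<close> by (simp add: power2_eq_square field_simps)
  finally have bad: "prob {x \<in> space (types_measure n). real (card (window n c w x)) \<le> real n * w / 2}
      \<le> exp (- (real n * w\<^sup>2 / 2))" by (simp only: card half)
  have bad_meas: "{x \<in> space (types_measure n). (\<Sum>i\<in>{1..n}. X i x) \<le> real n * w / 2} \<in> events"
    by measurable
  have "1 - prob ?good = prob (space (types_measure n) - ?good)"
    using good by (rule prob_compl[symmetric])
  also have "\<dots> \<le> prob {x \<in> space (types_measure n). real (card (window n c w x)) \<le> real n * w / 2}"
    using bad_meas[unfolded card] by (intro finite_measure_mono) auto
  also note bad
  finally show "1 - exp (- (real n * w\<^sup>2 / 2)) \<le> prob ?good" by simp
qed

lemma aas_types_window_ge:
  assumes c0: "\<forall>\<^sub>F n in sequentially. c0 n \<in> {0..1 - w n}"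
    and w: "\<And>n. 0 \<le> w n"
    and dense: "filterlim (\<lambda>n. real n * (w n)\<^sup>2) at_top sequentially"
  shows "aas_types (\<lambda>n x. real n * w n / 2 \<le> real (card (window n (c0 n) (w n) x)))"
proof (rule aas_typesI[where r = "\<lambda>n. exp (- (real n * (w n)\<^sup>2 / 2))"])
  show "(\<lambda>n. exp (- (real n * (w n)\<^sup>2 / 2))) \<longlonglongrightarrow> 0"
  proof (rule filterlim_compose[OF exp_at_bot])
    have "filterlim (\<lambda>n. 1 / 2 * (real n * (w n)\<^sup>2)) at_top sequentially"
      by (rule filterlim_tendsto_pos_mult_at_top[OF tendsto_const _ dense]) simp
    then show "filterlim (\<lambda>n. - (real n * (w n)\<^sup>2 / 2)) at_bot sequentially"
      by (simp add: filterlim_uminus_at_bot)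
  qed
  show "\<forall>\<^sub>F n in sequentially.
      {x \<in> space (types_measure n). real n * w n / 2 \<le> real (card (window n (c0 n) (w n) x))}
        \<in> sets (types_measure n) \<and>
      1 - exp (- (real n * (w n)\<^sup>2 / 2)) \<le> measure (types_measure n)
        {x \<in> space (types_measure n). real n * w n / 2 \<le> real (card (window n (c0 n) (w n) x))}"
    using c0 eventually_gt_at_top[of 0]
  proof eventually_elim
    case (elim n)
    then have "0 < n" "0 \<le> c0 n" "c0 n + w n \<le> 1" by auto
    then show ?case by (intro conjI prob_window_ge w)
  qed
qed

section \<open>Balancing the powers of n\<close>

text \<open>
  The number of subsets times the local limit bound.  With \<open>c\<close> lowered to at most 1, the base of the
  Gaussian prefactor is at most 1, so that its exponent \<open>y - 1\<close> may be raised to \<open>y\<close>; everything is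
  then a \<open>y\<close>-th power, up to the penalty, for which \<open>(2 + z)\<^sup>2 \<le> 8 + 2 z\<^sup>2\<close> is enough.  In \<open>K\<close>, the terms
  come from the number of subsets (\<open>ln 4\<close>), from \<open>y \<le> 2 N powr (1/2 - \<epsilon>)\<close> in the prefactor (\<open>ln 2 / 2\<close>),
  from \<open>c\<close>, and from the penalty.
\<close>

lemma binomial_times_llt_bound_ge:
  fixes N c C L \<epsilon> :: real and y b :: nat
  assumes N: "1 \<le> N" and eps: "0 < \<epsilon>" and c: "0 < c" and C: "0 < C" and L: "0 \<le> L"
    and y: "1 \<le> y" "real y \<le> 2 * N powr (1 / 2 - \<epsilon>)"
    and b: "y \<le> b" "N powr (3 / 4) / 2 \<le> real b"
  defines "K \<equiv> ln 4 + ln 2 / 2 - ln (min c 1) + C * (8 + 4 * L\<^sup>2)"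
  shows "exp (real y * (3 / 2 * \<epsilon> * ln N - K)) \<le>
    real (b choose y) * ((c / sqrt (real y)) ^ (y - 1) * exp (- C * (2 + L * N powr (- 1 / 4) * real y)\<^sup>2))"
proof -
  define d where "d = min c 1"
  have d: "0 < d" "d \<le> c" "d \<le> 1" using c by (auto simp: d_def)
  have Y: "1 \<le> real y" using y by simp
  have subsets: "exp (real y * ((1 / 4 + \<epsilon>) * ln N - ln 4)) \<le> real (b choose y)"
  proof -
    have "N powr (1 / 4 + \<epsilon>) / 4 = (N powr (3 / 4) / 2) / (2 * N powr (1 / 2 - \<epsilon>))"
      by (simp add: powr_diff[symmetric] field_simps powr_add[symmetric])
    also have "\<dots> \<le> real b / real y"
      using b y by (intro frac_le) auto
    finally have base: "N powr (1 / 4 + \<epsilon>) / 4 \<le> real b / real y" .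
    have "exp (real y * ((1 / 4 + \<epsilon>) * ln N - ln 4)) = exp ((1 / 4 + \<epsilon>) * ln N - ln 4) ^ y"
      by (rule exp_of_nat_mult)
    also have "exp ((1 / 4 + \<epsilon>) * ln N - ln 4) = N powr (1 / 4 + \<epsilon>) / 4"
      using N by (simp add: exp_diff powr_def)
    also have "(N powr (1 / 4 + \<epsilon>) / 4) ^ y \<le> (real b / real y) ^ y"
      using base by (intro power_mono) auto
    also have "\<dots> \<le> real (b choose y)"
      using b(1) by (rule binomial_ge_n_over_k_pow_k)
    finally show ?thesis .
  qed
  have prefactor: "exp (real y * (ln d - (ln 2 + (1 / 2 - \<epsilon>) * ln N) / 2)) \<le> (c / sqrt (real y)) ^ (y - 1)"
  proof -
    have "ln (real y) \<le> ln (2 * N powr (1 / 2 - \<epsilon>))"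
      using y Y N by (subst ln_le_cancel_iff) auto
    also have "\<dots> = ln 2 + (1 / 2 - \<epsilon>) * ln N"
      using N by (simp add: ln_mult ln_powr)
    finally have "real y * (ln d - (ln 2 + (1 / 2 - \<epsilon>) * ln N) / 2) \<le> real y * (ln d - ln (real y) / 2)"
      by (intro mult_left_mono) auto
    then have "exp (real y * (ln d - (ln 2 + (1 / 2 - \<epsilon>) * ln N) / 2))
        \<le> exp (real y * (ln d - ln (real y) / 2))" by simp
    also have "\<dots> = exp (ln d - ln (real y) / 2) ^ y" by (rule exp_of_nat_mult)
    also have "exp (ln d - ln (real y) / 2) = d / sqrt (real y)"
      using d Y by (simp add: exp_diff ln_sqrt[symmetric])
    also have "(d / sqrt (real y)) ^ y \<le> (d / sqrt (real y)) ^ (y - 1)"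
      using d Y by (intro power_decreasing) (auto simp: divide_le_eq_1 intro: order.trans)
    also have "\<dots> \<le> (c / sqrt (real y)) ^ (y - 1)"
      using d by (intro power_mono divide_right_mono) auto
    finally show ?thesis .
  qed
  have penalty: "(2 + L * N powr (- 1 / 4) * real y)\<^sup>2 \<le> real y * (8 + 4 * L\<^sup>2)"
  proof -
    have "(N powr (- 1 / 4))\<^sup>2 = N powr (- 1 / 2)"
      by (simp add: power2_eq_square powr_add[symmetric])
    then have "(N powr (- 1 / 4))\<^sup>2 * real y \<le> N powr (- 1 / 2) * (2 * N powr (1 / 2 - \<epsilon>))"
      using y by (simp add: mult_left_mono)
    also have "\<dots> = 2 * N powr (- \<epsilon>)"
      by (simp add: powr_add[symmetric])
    also have "\<dots> \<le> 2"
      using N eps powr_mono[of "- \<epsilon>" 0 N] by simp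
    finally have "2 * L\<^sup>2 * real y * ((N powr (- 1 / 4))\<^sup>2 * real y) \<le> 2 * L\<^sup>2 * real y * 2"
      by (intro mult_left_mono) auto
    moreover have "(2 + z)\<^sup>2 \<le> 8 + 2 * z\<^sup>2" for z :: real
      using zero_le_power2[of "z - 2"] by (simp add: power2_eq_square algebra_simps)
    from this[of "L * N powr (- 1 / 4) * real y"]
    have "(2 + L * N powr (- 1 / 4) * real y)\<^sup>2
        \<le> 8 + 2 * L\<^sup>2 * real y * ((N powr (- 1 / 4))\<^sup>2 * real y)"
      by (simp add: power2_eq_square mult_ac)
    ultimately have "(2 + L * N powr (- 1 / 4) * real y)\<^sup>2 \<le> 8 + 2 * L\<^sup>2 * real y * 2"
      by linarith
    also have "\<dots> \<le> real y * (8 + 4 * L\<^sup>2)" using Y by (simp add: distrib_left)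
    finally show ?thesis .
  qed
  have "exp (real y * (3 / 2 * \<epsilon> * ln N - K))
      = exp (real y * ((1 / 4 + \<epsilon>) * ln N - ln 4)) *
        (exp (real y * (ln d - (ln 2 + (1 / 2 - \<epsilon>) * ln N) / 2)) *
         exp (- C * (real y * (8 + 4 * L\<^sup>2))))"
    unfolding exp_add[symmetric] K_def d_def[symmetric] by (simp add: field_simps)
  also have "\<dots> \<le> real (b choose y) * ((c / sqrt (real y)) ^ (y - 1) *
      exp (- C * (2 + L * N powr (- 1 / 4) * real y)\<^sup>2))"
    using subsets prefactor penalty C c
    by (intro mult_mono) auto
  finally show ?thesis .
qed

section \<open>The expected number of regular subsets tends to infinity\<close>

theorem proposition4p5:
  fixes \<epsilon> p0 L :: real
    and W :: "real \<times> real \<Rightarrow> real"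
    and c0 w :: "nat \<Rightarrow> real"
    and y :: "nat \<Rightarrow> nat"
  assumes eps: "0 < \<epsilon>" "\<epsilon> < 1 / 8"
    and p0: "0 < p0" "p0 < 1 / 2"
    and W_range: "\<And>a b. a \<in> {0..1} \<Longrightarrow> b \<in> {0..1} \<Longrightarrow> W (a, b) \<in> {p0..1 - p0}"
    and W_sym: "\<And>a b. a \<in> {0..1} \<Longrightarrow> b \<in> {0..1} \<Longrightarrow> W (a, b) = W (b, a)"
    and W_lipschitz: "L-lipschitz_on ({0..1} \<times> {0..1}) W"
    and L_least: "\<And>L'. L'-lipschitz_on ({0..1} \<times> {0..1}) W \<Longrightarrow> L \<le> L'"
    and L_pos: "L > 0"
    and w_def: "w = (\<lambda>n. real n powr (- 1 / 4))"
    and y_def: "y = (\<lambda>n. nat \<lceil>real n powr (1 / 2 - \<epsilon>)\<rceil>)"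
    and c0: "\<forall>\<^sub>F n in sequentially. c0 n \<in> {0..1 - w n}"
    and llt: "LLT W c0 w y"
  shows "\<exists>\<delta> :: nat \<Rightarrow> real. \<delta> \<longlonglongrightarrow> 0 \<and>
    aas_types (\<lambda>n x.
      measure_pmf.expectation (graph_given_types n W x)
          (num_regular_subsets (window n (c0 n) (w n) x) (y n))
        \<ge> exp (3 / 2 * \<epsilon> * real (y n) * ln (real n) * (1 - \<delta> n))) \<and>
    filterlim (\<lambda>n. exp (3 / 2 * \<epsilon> * real (y n) * ln (real n) * (1 - \<delta> n))) at_top sequentially"
proof -
  from llt obtain c C where c: "0 < c" and C: "0 < C" and llt': "aas_types (\<lambda>n x.
        \<forall>S. S \<subseteq> window n (c0 n) (w n) x \<and> card S = y n \<longrightarrow>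
          (let t = target_degree W x S in
            measure_pmf.prob (graph_given_types n W x)
                {E. regular_of_degree t S (induced_edges E S)}
              \<ge> (c / sqrt (real (y n))) ^ (y n - 1) *
                 exp (- (C / real (y n)) * (\<Sum>v\<in>S. (real t - mean_degree W x S v)\<^sup>2))))"
    unfolding LLT_def by blast
  define K where "K = ln 4 + ln 2 / 2 - ln (min c 1) + C * (8 + 4 * L\<^sup>2)"
  define \<delta> where "\<delta> n = K / (3 / 2 * \<epsilon> * ln (real n))" for n :: nat
  have ln_top: "filterlim (\<lambda>n. 3 / 2 * \<epsilon> * ln (real n)) at_top sequentially"
    using eps by (intro filterlim_tendsto_pos_mult_at_top[OF tendsto_const]
        filterlim_compose[OF ln_at_top filterlim_real_sequentially]) auto
  have \<delta>0: "\<delta> \<longlonglongrightarrow> 0"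
    unfolding \<delta>_def
    by (rule real_tendsto_divide_at_top[OF tendsto_const ln_top])
  \<comment> \<open>The choice of \<open>\<delta>\<close> turns the relative error into an additive loss of \<open>K\<close> per vertex.\<close>
  have exponent: "3 / 2 * \<epsilon> * real (y n) * ln (real n) * (1 - \<delta> n)
      = real (y n) * (3 / 2 * \<epsilon> * ln (real n) - K)" if "2 \<le> n" for n
    using that eps by (simp add: \<delta>_def field_simps)
  have w0: "0 \<le> w n" for n by (simp add: w_def)
  have nw: "real n * w n = real n powr (3 / 4)" if "1 \<le> n" for n
    using that powr_add[of "real n" 1 "- 1 / 4"] by (simp add: w_def)
  have y_ge1: "1 \<le> y n" if "1 \<le> n" for n
    using that by (simp add: y_def Suc_le_eq)
  have y_le: "real (y n) \<le> 2 * real n powr (1 / 2 - \<epsilon>)" if "1 \<le> n" for n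
  proof -
    have "1 \<le> real n powr (1 / 2 - \<epsilon>)" using that eps by (intro ge_one_powr_ge_zero) auto
    then show ?thesis unfolding y_def by linarith
  qed
  have window_size: "aas_types (\<lambda>n x. real n * w n / 2 \<le> real (card (window n (c0 n) (w n) x)))"
  proof (rule aas_types_window_ge[OF c0 w0])
    have "filterlim (\<lambda>n. real n powr (1 / 2)) at_top sequentially"
      by (rule filterlim_compose[OF real_powr_at_top filterlim_real_sequentially]) simp
    moreover have "\<forall>\<^sub>F n in sequentially. real n powr (1 / 2) = real n * (w n)\<^sup>2"
      using eventually_gt_at_top[of 0]
    proof eventually_elim
      case (elim n)
      then show ?case
        using powr_add[of "real n" 1 "- 1 / 2"]
        by (simp add: w_def power2_eq_square powr_add[symmetric])
    qed
    ultimately show "filterlim (\<lambda>n. real n * (w n)\<^sup>2) at_top sequentially"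
      by (rule filterlim_mono_eventually[OF _ order.refl order.refl])
  qed
  have "aas_types (\<lambda>n x.
      measure_pmf.expectation (graph_given_types n W x)
          (num_regular_subsets (window n (c0 n) (w n) x) (y n))
        \<ge> exp (3 / 2 * \<epsilon> * real (y n) * ln (real n) * (1 - \<delta> n)))"
    using llt' window_size
  proof (rule aas_types_conj_mono)
    show "\<forall>\<^sub>F n in sequentially. \<forall>x.
      (\<forall>S. S \<subseteq> window n (c0 n) (w n) x \<and> card S = y n \<longrightarrow>
          (let t = target_degree W x S in
            measure_pmf.prob (graph_given_types n W x)
                {E. regular_of_degree t S (induced_edges E S)}
              \<ge> (c / sqrt (real (y n))) ^ (y n - 1) *
                 exp (- (C / real (y n)) * (\<Sum>v\<in>S. (real t - mean_degree W x S v)\<^sup>2)))) \<longrightarrow>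
      real n * w n / 2 \<le> real (card (window n (c0 n) (w n) x)) \<longrightarrow>
      measure_pmf.expectation (graph_given_types n W x)
          (num_regular_subsets (window n (c0 n) (w n) x) (y n))
        \<ge> exp (3 / 2 * \<epsilon> * real (y n) * ln (real n) * (1 - \<delta> n))"
      using c0 eventually_ge_at_top[of 256]
    proof eventually_elim
      case (elim n)
      show ?case
      proof (intro allI impI)
        fix x
        let ?B = "window n (c0 n) (w n) x"
        let ?q = "(c / sqrt (real (y n))) ^ (y n - 1) * exp (- C * (2 + L * w n * real (y n))\<^sup>2)"
        assume llt_x: "\<forall>S. S \<subseteq> ?B \<and> card S = y n \<longrightarrow>
          (let t = target_degree W x S in
            measure_pmf.prob (graph_given_types n W x)
                {E. regular_of_degree t S (induced_edges E S)}
              \<ge> (c / sqrt (real (y n))) ^ (y n - 1) *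
                 exp (- (C / real (y n)) * (\<Sum>v\<in>S. (real t - mean_degree W x S v)\<^sup>2)))"
          and large: "real n * w n / 2 \<le> real (card ?B)"
        have fin: "finite ?B" by (simp add: window_def)
        have Y: "0 < real (y n)" using y_ge1[of n] elim by simp
        have b: "real n powr (3 / 4) / 2 \<le> real (card ?B)"
          using large nw[of n] elim by simp
        have "y n \<le> card ?B"
        proof -
          \<comment> \<open>The threshold 256 for \<open>n\<close> makes \<open>n powr (1/4)\<close> at least 4, which absorbs both factors 2.\<close>
          have "4 = (256::real) powr (1 / 4)"
            using powr_powr[of 4 4 "1 / 4"] by simp
          also have "\<dots> \<le> real n powr (1 / 4)"
            using elim by (intro powr_mono2) auto
          finally have "4 * real n powr (1 / 2) \<le> real n powr (1 / 4) * real n powr (1 / 2)"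
            by (intro mult_right_mono) auto
          also have "\<dots> = real n powr (3 / 4)" by (simp add: powr_add[symmetric])
          finally have "2 * real n powr (1 / 2) \<le> real n powr (3 / 4) / 2" by simp
          moreover have "real n powr (1 / 2 - \<epsilon>) \<le> real n powr (1 / 2)"
            using eps elim by (intro powr_mono) auto
          ultimately have "real (y n) \<le> real (card ?B)"
            using y_le[of n] b elim by linarith
          then show ?thesis by simp
        qed
        have regular_ge: "?q \<le> measure_pmf.prob (graph_given_types n W x)
            {E. regular_of_degree (target_degree W x S) S (induced_edges E S)}"
          if S: "S \<subseteq> ?B" "card S = y n" for S
        proof -
          have in_window: "c0 n \<le> x u" "x u \<le> c0 n + w n" if "u \<in> S" for u
            using S(1) that by (auto simp: window_def)
          have unit: "x ` S \<subseteq> {0..1}"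
          proof
            fix a assume "a \<in> x ` S"
            then obtain u where "a = x u" "u \<in> S" by blast
            then show "a \<in> {0..1}" using in_window[of u] elim(1) by simp
          qed
          have width: "\<bar>x u - x v\<bar> \<le> w n" if "u \<in> S" "v \<in> S" for u v
            using in_window[OF that(1)] in_window[OF that(2)] by linarith
          have "(\<Sum>v\<in>S. (real (target_degree W x S) - mean_degree W x S v)\<^sup>2)
              \<le> real (card S) * (2 + L * w n * real (card S))\<^sup>2"
            using W_range p0 finite_subset[OF S(1) fin]
            by (intro sum_target_deviation_le[OF _ unit W_sym W_lipschitz _ width]) force+
          then have "C / real (y n) * (\<Sum>v\<in>S. (real (target_degree W x S) - mean_degree W x S v)\<^sup>2)
              \<le> C / real (y n) * (real (y n) * (2 + L * w n * real (y n))\<^sup>2)"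
            using C Y S by (intro mult_left_mono) auto
          then have "?q \<le> (c / sqrt (real (y n))) ^ (y n - 1) * exp (- (C / real (y n)) *
              (\<Sum>v\<in>S. (real (target_degree W x S) - mean_degree W x S v)\<^sup>2))"
            using Y c by (intro mult_left_mono) auto
          also have "\<dots> \<le> measure_pmf.prob (graph_given_types n W x)
              {E. regular_of_degree (target_degree W x S) S (induced_edges E S)}"
            using llt_x S by (auto simp: Let_def)
          finally show ?thesis .
        qed
        have "exp (3 / 2 * \<epsilon> * real (y n) * ln (real n) * (1 - \<delta> n))
            = exp (real (y n) * (3 / 2 * \<epsilon> * ln (real n) - K))"
          using exponent[of n] elim by simp
        also have "\<dots> \<le> real (card ?B choose y n) * ?q"
          unfolding K_def w_def
          using elim eps c C L_pos y_ge1[of n] y_le[of n] \<open>y n \<le> card ?B\<close> b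
          by (intro binomial_times_llt_bound_ge) (auto simp: w_def)
        also have "\<dots> \<le> measure_pmf.expectation (graph_given_types n W x)
            (num_regular_subsets ?B (y n))"
          by (rule expectation_num_regular_subsets_ge[OF fin regular_ge])
        finally show "exp (3 / 2 * \<epsilon> * real (y n) * ln (real n) * (1 - \<delta> n))
          \<le> measure_pmf.expectation (graph_given_types n W x) (num_regular_subsets ?B (y n))" .
      qed
    qed
  qed
  moreover have "filterlim (\<lambda>n. exp (3 / 2 * \<epsilon> * real (y n) * ln (real n) * (1 - \<delta> n))) at_top sequentially"
  proof (rule filterlim_compose[OF exp_at_top])
    have lin: "filterlim (\<lambda>n. 3 / 2 * \<epsilon> * ln (real n) - K) at_top sequentially"
      using filterlim_tendsto_add_at_top[OF tendsto_const[of "- K"] ln_top] by simp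
    moreover have "\<forall>\<^sub>F n in sequentially. 3 / 2 * \<epsilon> * ln (real n) - K
        \<le> 3 / 2 * \<epsilon> * real (y n) * ln (real n) * (1 - \<delta> n)"
      using eventually_ge_at_top[of 2] lin[unfolded filterlim_at_top, rule_format, of 0]
    proof eventually_elim
      case (elim n)
      then have "1 * (3 / 2 * \<epsilon> * ln (real n) - K) \<le> real (y n) * (3 / 2 * \<epsilon> * ln (real n) - K)"
        using y_ge1[of n] by (intro mult_right_mono) auto
      then show ?case by (simp only: exponent[OF elim(1)] mult_1)
    qed
    ultimately show "filterlim (\<lambda>n. 3 / 2 * \<epsilon> * real (y n) * ln (real n) * (1 - \<delta> n)) at_top sequentially"
      by (rule filterlim_at_top_mono)
  qed
  ultimately show ?thesis using \<delta>0 by blast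
qed

end
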